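(* Let $G$ be an abelian noncyclic $2$-group. Then there exists a $(G,2,0)$ contracted difference matrix.
   Context: All groups are finite, and abelian groups are written additively. Difference matrix: for a non-trivial group $G$, a $(G,m,\lambda)$ difference matrix is an $m\times\lambda|G|$ matrix $(a_{ij})$ with entries in $G$ such that, for all distinct rows $i$ and $\ell$, the multiset of differences $\{a_{ij}-a_{\ell j} : 0\le j\le \lambda|G|-1\}$ contains each element of $G$ exactly $\lambda$ times. $p$-expansion: let $p$ be prime and let $M$ be a $k\times\ell$ matrix over an abelian $p$-group $G$. The $p$-expansion $f_p(M)$ is the $p^k\times p^\ell$ matrix over $G$ whose rows are indexed by $\mathbf{r}\in\mathbb{Z}_p^k$ and whose columns are indexed by $\mathbf{c}\in\mathbb{Z}_p^\ell$, with $(\mathbf{r},\mathbf{c})$ entry $\mathbf{r}M\mathbf{c}^{\intercal}=\sum_{i,j} r_i c_j M_{ij}$, where $\mathbf r,\mathbf c$ are row vectors whose entries are taken as the integer representatives in $\{0,1,\dots,p-1\}$, and integers act on $G$ in the usual way. Contracted difference matrix: let $p$ be prime and let $G$ be an abelian group of order $p^n$. A $k\times(n+s)$ matrix $M$ over $G$ is a $(G,k,s)$ contracted difference matrix if the $p^k\times p^{n+s}$ matrix $f_p(M)$ is a $(G,p^k,p^s)$ difference matrix. *)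

theory Defs
  imports "HOL-Algebra.FiniteProduct" "HOL-Algebra.Elementary_Groups" "HOL-Library.FuncSet"
    "HOL-Computational_Algebra.Primes"
begin

text \<open>
  Groups are HOL-Algebra groups, hence written multiplicatively: the difference
  \<open>x - y\<close> is \<open>x \<otimes> inv y\<close> and the multiple \<open>t x\<close> is \<open>x [^] t\<close>.

  A matrix is a function of a row and a column index together with explicit finite sets
  \<open>R\<close> and \<open>C\<close> of row and column indices; values outside \<open>R \<times> C\<close> are irrelevant.
  General index sets are needed because the rows and columns of a \<open>p\<close>-expansion
  are indexed by tuples; being a difference matrix does not depend on how
  the rows and columns are ordered.
\<close>

definition matrix_over :: "('a, 'm) monoid_scheme \<Rightarrow> 'r set \<Rightarrow> 'c set \<Rightarrow> ('r \<Rightarrow> 'c \<Rightarrow> 'a) \<Rightarrow> bool"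
  where "matrix_over G R C a \<longleftrightarrow>
    finite R \<and> finite C \<and> (\<forall>i\<in>R. \<forall>j\<in>C. a i j \<in> carrier G)"

definition difference_matrix ::
  "('a, 'm) monoid_scheme \<Rightarrow> nat \<Rightarrow> nat \<Rightarrow> 'r set \<Rightarrow> 'c set \<Rightarrow> ('r \<Rightarrow> 'c \<Rightarrow> 'a) \<Rightarrow> bool"
  where "difference_matrix G m \<mu> R C a \<longleftrightarrow>
    group G \<and> finite (carrier G) \<and> carrier G \<noteq> {\<one>\<^bsub>G\<^esub>} \<and>
    matrix_over G R C a \<and> card R = m \<and> card C = \<mu> * order G \<and>
    (\<forall>i\<in>R. \<forall>l\<in>R. i \<noteq> l \<longrightarrow>
      (\<forall>g\<in>carrier G. card {j \<in> C. a i j \<otimes>\<^bsub>G\<^esub> inv\<^bsub>G\<^esub> (a l j) = g} = \<mu>))"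

text \<open>
  \<open>\<int>\<^sub>p\<^sup>k\<close> via the representatives \<open>0, \<dots>, p - 1\<close>; extensionality makes
  distinct functions represent distinct tuples.
\<close>

definition tuples :: "nat \<Rightarrow> nat \<Rightarrow> (nat \<Rightarrow> nat) set"
  where "tuples p k = {..<k} \<rightarrow>\<^sub>E {..<p}"

text \<open>
  The \<open>(r, c)\<close> entry of the \<open>p\<close>-expansion of a \<open>k \<times> l\<close> matrix \<open>M\<close>; the row and column
  index sets are \<open>tuples p k\<close> and \<open>tuples p l\<close>, so \<open>p\<close> itself does not occur in the formula.
\<close>

definition expansion ::
  "('a, 'm) monoid_scheme \<Rightarrow> nat \<Rightarrow> nat \<Rightarrow> (nat \<Rightarrow> nat \<Rightarrow> 'a) \<Rightarrow>
    (nat \<Rightarrow> nat) \<Rightarrow> (nat \<Rightarrow> nat) \<Rightarrow> 'a"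
  where "expansion G k l M r c =
    finprod G (\<lambda>(i, j). M i j [^]\<^bsub>G\<^esub> (r i * c j)) ({..<k} \<times> {..<l})"

definition contracted_difference_matrix ::
  "nat \<Rightarrow> ('a, 'm) monoid_scheme \<Rightarrow> nat \<Rightarrow> nat \<Rightarrow> (nat \<Rightarrow> nat \<Rightarrow> 'a) \<Rightarrow> bool"
  where "contracted_difference_matrix p G k s M \<longleftrightarrow>
    prime p \<and> comm_group G \<and>
    (\<exists>n. order G = p ^ n \<and>
      matrix_over G {..<k} {..<n + s} M \<and>
      difference_matrix G (p ^ k) (p ^ s) (tuples p k) (tuples p (n + s))
        (expansion G k (n + s) M))"

end

theory Submission
  imports Defs "HOL-Algebra.Multiplicative_Group"
begin

text \<open>
  Let the two rows of a matrix over \<open>G\<close> be \<open>a\<close> and \<open>b\<close>, each with \<open>n\<close> entries, where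
  \<open>G\<close> has order \<open>2\<^sup>n\<close>. Up to inversion, the quotients of two distinct rows of the
  2-expansion are the maps sending a tuple in \<open>{0, 1}\<^sup>n\<close> to the corresponding subproduct of
  one of the sequences \<open>a\<^sub>j\<close>, \<open>b\<^sub>j\<close>, \<open>a\<^sub>j b\<^sub>j\<close>, \<open>a\<^sub>j b\<^sub>j\<inverse>\<close>. So the matrix is a contracted
  difference matrix exactly if the subproducts of each of these four sequences cover \<open>G\<close>; they
  are then automatically distinct, since there are \<open>2\<^sup>n\<close> of them
  (\<open>contracted_of_pair_basis\<close>).

  The four conditions are relativised to a pair of subgroups \<open>K \<subseteq> L\<close>: the subproducts of each
  sequence, multiplied by \<open>K\<close>, have to cover \<open>L\<close>, with \<open>[L : K] = 2\<^sup>l\<close> for sequences of length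
  \<open>l\<close> (\<open>pair_basis\<close>). Concatenation then composes a solution from \<open>K\<close> to \<open>L\<close> with
  one from \<open>L\<close> to \<open>N\<close>, and no quotient groups have to be formed.

  The building block is a shift (\<open>pair_basis_shift\<close>). Take a chain of subgroups
  \<open>K = G\<^sub>0 \<subset> G\<^sub>1 \<subset> \<dots> \<subset> G\<^sub>l = L\<close> with
  all indices two and \<open>l \<ge> 2\<close>, choose \<open>x\<^sub>i\<close> in \<open>G\<^sub>i - G\<^sub>i\<^sub>-\<^sub>1\<close>, and put
  \<open>a = (x\<^sub>1, \<dots>, x\<^sub>l)\<close> and \<open>b = (x\<^sub>2, \<dots>, x\<^sub>l, x\<^sub>l x\<^sub>1)\<close>. Except for the last one, the entries of
  \<open>a b\<close> and \<open>a b\<inverse>\<close> lie in \<open>G\<^sub>2 - G\<^sub>1, G\<^sub>3 - G\<^sub>2, \<dots>\<close> again. If moreover \<open>x\<^sub>l\<^sup>2 \<in> K\<close>, then the last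
  entries \<open>x\<^sub>l\<^sup>2 x\<^sub>1\<close> and \<open>x\<^sub>1\<inverse>\<close> supply the missing step from \<open>K\<close> to \<open>G\<^sub>1\<close>, and
  \<open>x\<^sub>l, x\<^sub>l x\<^sub>1\<close> cover the same elements over \<open>K\<close> as \<open>x\<^sub>1, x\<^sub>l\<close>. So the shift works.

  Induction on the index of \<open>K\<close> now connects \<open>K\<close> to \<open>G\<close> whenever \<open>G / K\<close> contains a Klein
  four-group, generated by the classes of \<open>u\<close> and \<open>v\<close> say (\<open>ex_pair_basis\<close>).
  If some \<open>e\<close> with \<open>e\<^sup>2 \<in> K\<close> is not a square modulo \<open>K\<close>, then there is a chain from \<open>K\<close> to \<open>G\<close>
  whose last step adjoins \<open>e\<close>, and one shift does everything. Otherwise \<open>u\<close> and \<open>v\<close> are squares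
  modulo \<open>K\<close>, of \<open>x\<close> and \<open>y\<close> say. A shift leads from \<open>K\<close> to \<open>V = \<langle>K, u, v\<rangle>\<close>, and \<open>x\<close> and \<open>y\<close>
  generate a Klein four-group in \<open>G / V\<close>, so that the induction continues with \<open>V\<close>.

  It starts at the trivial subgroup, because an abelian 2-group with at most one involution is
  cyclic (\<open>ex_two_involutions\<close>).
\<close>

section \<open>Adjoining elements to a subgroup\<close>

context comm_group
begin

text \<open>
  The factor \<open>{1, x}\<close> in a subproduct. For \<open>M\<close> a subgroup this is in general not the subgroup
  generated by \<open>M\<close> and \<open>x\<close>; it is one if \<open>x\<^sup>2 \<in> M\<close>. Keeping it a mere set allows the factors
  to be permuted freely, also when the intermediate sets are not subgroups.
\<close>

definition adjoin :: "'a set \<Rightarrow> 'a \<Rightarrow> 'a set"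
  where "adjoin M x = M \<union> (\<lambda>m. x \<otimes> m) ` M"

text \<open>The products of an element of the given set with a subproduct of the list.\<close>

abbreviation span :: "'a set \<Rightarrow> 'a list \<Rightarrow> 'a set"
  where "span \<equiv> foldl adjoin"

text \<open>
  If \<open>M\<close> is a subgroup, then adjoining the elements of the list one after the other gives a chain
  of subgroups, each of index two in the next.
\<close>

fun tower :: "'a set \<Rightarrow> 'a list \<Rightarrow> bool"
  where
    "tower M [] \<longleftrightarrow> True"
  | "tower M (x # xs) \<longleftrightarrow> x \<in> carrier G \<and> x \<notin> M \<and> x \<otimes> x \<in> M \<and> tower (adjoin M x) xs"

lemma adjoin_closed: "M \<subseteq> carrier G \<Longrightarrow> x \<in> carrier G \<Longrightarrow> adjoin M x \<subseteq> carrier G"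
  by (auto simp: adjoin_def)

lemma adjoin_mono: "M \<subseteq> adjoin M x"
  by (auto simp: adjoin_def)

lemma mem_adjoin: "subgroup M G \<Longrightarrow> x \<in> carrier G \<Longrightarrow> x \<in> adjoin M x"
  by (auto simp: adjoin_def image_iff intro!: bexI[of _ \<one>] subgroup.one_closed)

lemma adjoin_commute:
  assumes "M \<subseteq> carrier G" "x \<in> carrier G" "y \<in> carrier G"
  shows "adjoin (adjoin M x) y = adjoin (adjoin M y) x"
proof -
  have "y \<otimes> (x \<otimes> m) = x \<otimes> (y \<otimes> m)" if "m \<in> M" for m
    using assms that by (auto intro: m_lcomm)
  then show ?thesis by (auto simp: adjoin_def image_Un image_image)
qed

lemma span_closed:
  "M \<subseteq> carrier G \<Longrightarrow> set xs \<subseteq> carrier G \<Longrightarrow> span M xs \<subseteq> carrier G"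
  by (induction xs arbitrary: M) (auto simp: adjoin_closed)

lemma adjoin_span:
  assumes "M \<subseteq> carrier G" "set xs \<subseteq> carrier G" "y \<in> carrier G"
  shows "adjoin (span M xs) y = span (adjoin M y) xs"
  using assms by (induction xs arbitrary: M) (auto simp: adjoin_closed adjoin_commute)

lemma subgroup_adjoin:
  assumes M: "subgroup M G" and x: "x \<in> carrier G" "x \<otimes> x \<in> M"
  shows "subgroup (adjoin M x) G"
proof -
  interpret M: subgroup M G by (rule M)
  have xm: "x \<otimes> m \<in> adjoin M x" "m \<in> adjoin M x" if "m \<in> M" for m
    using that by (auto simp: adjoin_def)
  show ?thesis
  proof (rule subgroupI)
    show "adjoin M x \<subseteq> carrier G" using M.subset x by (simp add: adjoin_closed)
    show "adjoin M x \<noteq> {}" using M.one_closed adjoin_mono by blast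
  next
    fix a assume "a \<in> adjoin M x"
    then consider "a \<in> M" | m where "m \<in> M" "a = x \<otimes> m" by (auto simp: adjoin_def)
    then show "inv a \<in> adjoin M x"
    proof cases
      case 1 then show ?thesis by (simp add: xm)
    next
      case 2
      then have "inv a = x \<otimes> (inv (x \<otimes> x) \<otimes> inv m)"
        using x by (simp add: inv_mult m_assoc[symmetric])
      then show ?thesis using 2 x by (simp add: xm)
    qed
  next
    fix a b assume "a \<in> adjoin M x" "b \<in> adjoin M x"
    then consider "a \<in> M" "b \<in> M" | m where "a \<in> M" "m \<in> M" "b = x \<otimes> m"
      | m where "m \<in> M" "a = x \<otimes> m" "b \<in> M"
      | m m' where "m \<in> M" "m' \<in> M" "a = x \<otimes> m" "b = x \<otimes> m'"
      by (auto simp: adjoin_def)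
    then show "a \<otimes> b \<in> adjoin M x"
    proof cases
      case 1 then show ?thesis by (simp add: xm)
    next
      case 2
      then have "a \<otimes> b = x \<otimes> (a \<otimes> m)" using x by (simp add: m_lcomm)
      then show ?thesis using 2 by (simp add: xm)
    next
      case 3
      then have "a \<otimes> b = x \<otimes> (m \<otimes> b)" using x by (simp add: m_assoc)
      then show ?thesis using 3 by (simp add: xm)
    next
      case 4
      then have "a \<otimes> b = (x \<otimes> x) \<otimes> (m \<otimes> m')" using x by (simp add: m_ac)
      then show ?thesis using 4 x by (simp add: xm)
    qed
  qed
qed

text \<open>Adjoining depends only on the coset \<open>x M\<close>. This is what makes the shift work.\<close>

lemma adjoin_absorb:
  assumes M: "subgroup M G" and x: "x \<in> carrier G" and a: "a \<in> M"
  shows "adjoin M (a \<otimes> x) = adjoin M x"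
proof -
  interpret M: subgroup M G by (rule M)
  have "(\<lambda>m. a \<otimes> x \<otimes> m) ` M = (\<lambda>m. x \<otimes> m) ` M"
  proof (intro equalityI image_subsetI)
    fix m assume m: "m \<in> M"
    then have "a \<otimes> x \<otimes> m = x \<otimes> (a \<otimes> m)" using a x by (simp add: m_ac)
    then show "a \<otimes> x \<otimes> m \<in> (\<lambda>m. x \<otimes> m) ` M" using a m by simp
    have "x \<otimes> m = a \<otimes> x \<otimes> (inv a \<otimes> m)"
    proof -
      have "a \<otimes> x \<otimes> (inv a \<otimes> m) = (a \<otimes> inv a) \<otimes> (x \<otimes> m)"
        using a x m by (simp only: m_ac M.mem_carrier m_closed inv_closed)
      then show ?thesis using a x m by simp
    qed
    then show "x \<otimes> m \<in> (\<lambda>m. a \<otimes> x \<otimes> m) ` M" using a m by simp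
  qed
  then show ?thesis by (simp add: adjoin_def)
qed

lemma adjoin_inv:
  assumes M: "subgroup M G" and x: "x \<in> carrier G" "x \<otimes> x \<in> M"
  shows "adjoin M (inv x) = adjoin M x"
proof -
  have "inv x = inv (x \<otimes> x) \<otimes> x" using x by (simp add: inv_mult m_assoc)
  then show ?thesis
    using adjoin_absorb[OF M x(1) subgroup.m_inv_closed[OF M x(2)]] by simp
qed

lemma card_adjoin:
  assumes M: "subgroup M G" "finite M" and x: "x \<in> carrier G" "x \<notin> M"
  shows "card (adjoin M x) = 2 * card M"
proof -
  interpret M: subgroup M G by (rule M)
  have "x \<otimes> m \<notin> M" if "m \<in> M" for m
  proof
    assume "x \<otimes> m \<in> M"
    then have "x \<otimes> m \<otimes> inv m \<in> M" using that by simp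
    then show False using that x by (simp add: m_assoc)
  qed
  then have "M \<inter> (\<lambda>m. x \<otimes> m) ` M = {}" by auto
  moreover have "inj_on (\<lambda>m. x \<otimes> m) M" using x by (auto simp: inj_on_def)
  ultimately show ?thesis using M(2) by (simp add: adjoin_def card_Un_disjoint card_image)
qed

lemma adjoin_minimal:
  assumes "subgroup A G" "M \<subseteq> A" "x \<in> A"
  shows "adjoin M x \<subseteq> A"
  using assms by (auto simp: adjoin_def subgroup.m_closed subset_iff)

section \<open>Towers of subgroups with steps of index two\<close>

lemma tower_append: "tower M (xs @ ys) \<longleftrightarrow> tower M xs \<and> tower (span M xs) ys"
  by (induction xs arbitrary: M) auto

lemma tower_carrier: "tower M xs \<Longrightarrow> set xs \<subseteq> carrier G"
  by (induction xs arbitrary: M) auto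

lemma subgroup_span: "subgroup M G \<Longrightarrow> tower M xs \<Longrightarrow> subgroup (span M xs) G"
  by (induction xs arbitrary: M) (auto simp: subgroup_adjoin)

lemma card_span:
  "subgroup M G \<Longrightarrow> finite M \<Longrightarrow> tower M xs \<Longrightarrow> card (span M xs) = 2 ^ length xs * card M"
proof (induction xs arbitrary: M)
  case (Cons x xs)
  then have "finite (adjoin M x)" by (simp add: adjoin_def)
  with Cons show ?case by (simp add: subgroup_adjoin card_adjoin)
qed simp

text \<open>Take the last of \<open>x, x\<^sup>2, x\<^sup>4, \<dots>\<close> before the sequence enters \<open>K\<close>.\<close>

lemma ex_square_into:
  assumes x: "x \<in> carrier G" "x \<notin> K" and n: "x [^] (2 ^ n :: nat) \<in> K"
  obtains j :: nat where "x [^] (2 ^ j :: nat) \<notin> K"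
    "x [^] (2 ^ j :: nat) \<otimes> x [^] (2 ^ j :: nat) \<in> K"
proof -
  define k where "k = (LEAST k. x [^] (2 ^ k :: nat) \<in> K)"
  have k: "x [^] (2 ^ k :: nat) \<in> K" unfolding k_def using n by (rule LeastI)
  then obtain j where j: "k = Suc j" using x by (cases k) auto
  then have "x [^] (2 ^ j :: nat) \<notin> K"
    using not_less_Least[of j "\<lambda>k. x [^] (2 ^ k :: nat) \<in> K"] by (auto simp: k_def)
  moreover have "x [^] (2 ^ j :: nat) \<otimes> x [^] (2 ^ j :: nat) \<in> K"
    using k x j by (simp add: nat_pow_mult mult_2)
  ultimately show ?thesis by (rule that)
qed

end

locale comm_2_group = comm_group +
  fixes n :: nat
  assumes order_2: "order G = 2 ^ n"
begin

lemma finite_carrier: "finite (carrier G)"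
  using order_2 order_gt_0_iff_finite by simp

lemma pow_2_n: "x \<in> carrier G \<Longrightarrow> x [^] (2 ^ n :: nat) = \<one>"
  using pow_order_eq_1[of x] order_2 by simp

lemma subgroup_subset: "subgroup K G \<Longrightarrow> K \<subseteq> carrier G"
  by (rule subgroup.subset)

lemma subgroup_finite: "subgroup K G \<Longrightarrow> finite K"
  using finite_carrier subgroup_subset finite_subset by blast

lemma nat_pow_in_subgroup: "subgroup A G \<Longrightarrow> x \<in> A \<Longrightarrow> x [^] (k :: nat) \<in> A"
  by (induction k) (auto simp: subgroup.one_closed subgroup.m_closed)

lemma ex_square_into_smaller:
  assumes "subgroup K G" "subgroup A G" "K \<subset> A"
  shows "\<exists>y\<in>A. y \<notin> K \<and> y \<otimes> y \<in> K"
proof -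
  obtain x where x: "x \<in> A" "x \<notin> K" using assms by blast
  then have xc: "x \<in> carrier G" using assms subgroup_subset by blast
  obtain j where "x [^] (2 ^ j :: nat) \<notin> K"
    "x [^] (2 ^ j :: nat) \<otimes> x [^] (2 ^ j :: nat) \<in> K"
    using ex_square_into[OF xc x(2)] pow_2_n[OF xc] subgroup.one_closed[OF assms(1)] by metis
  then show ?thesis using nat_pow_in_subgroup[OF assms(2) x(1)] by blast
qed

lemma card_diff_adjoin_less:
  assumes "K \<subseteq> carrier G" "y \<in> carrier G" "y \<notin> K" "subgroup K G"
  shows "card (carrier G - adjoin K y) < card (carrier G - K)"
  using assms finite_carrier adjoin_mono[of K y] mem_adjoin[of K y]
  by (intro psubset_card_mono) auto

lemma ex_tower:
  assumes "subgroup K G" "subgroup A G" "K \<subseteq> A"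
  shows "\<exists>xs. tower K xs \<and> span K xs = A"
  using assms
proof (induction "card (carrier G - K)" arbitrary: K rule: less_induct)
  case less
  show ?case
  proof (cases "K = A")
    case True
    then show ?thesis by (intro exI[of _ "[]"]) simp
  next
    case False
    then obtain y where y: "y \<in> A" "y \<notin> K" "y \<otimes> y \<in> K"
      using ex_square_into_smaller[OF less.prems(1,2)] less.prems(3) by blast
    then have yc: "y \<in> carrier G" using less.prems subgroup_subset by blast
    have "card (carrier G - adjoin K y) < card (carrier G - K)"
      using card_diff_adjoin_less less.prems yc y subgroup_subset by blast
    moreover have "subgroup (adjoin K y) G" using subgroup_adjoin less.prems yc y by blast
    moreover have "adjoin K y \<subseteq> A" using adjoin_minimal less.prems y by blast
    ultimately obtain xs where "tower (adjoin K y) xs" "span (adjoin K y) xs = A"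
      using less.hyps less.prems by blast
    then show ?thesis using y yc by (intro exI[of _ "y # xs"]) simp
  qed
qed

text \<open>
  If all squares lie in \<open>M\<close>, any element outside the current subgroup may be adjoined. Choosing it
  outside the subgroup enlarged by \<open>e\<close> keeps \<open>e\<close> available until \<open>e\<close> alone is missing.
\<close>

lemma ex_tower_to_complement:
  assumes "subgroup M G" "\<And>x. x \<in> carrier G \<Longrightarrow> x \<otimes> x \<in> M" "e \<in> carrier G" "e \<notin> M"
  shows "\<exists>xs. tower M (xs @ [e]) \<and> span M (xs @ [e]) = carrier G"
  using assms
proof (induction "card (carrier G - M)" arbitrary: M rule: less_induct)
  case less
  have sub: "subgroup (adjoin M e) G" using less.prems by (simp add: subgroup_adjoin)
  show ?case
  proof (cases "adjoin M e = carrier G")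
    case True
    then show ?thesis using less.prems by (intro exI[of _ "[]"]) simp
  next
    case False
    then obtain x where x: "x \<in> carrier G" "x \<notin> adjoin M e"
      using subgroup_subset[OF sub] by blast
    have xM: "x \<notin> M" using x adjoin_mono by blast
    have e: "e \<notin> adjoin M x"
    proof
      assume "e \<in> adjoin M x"
      then obtain m where m: "m \<in> M" "e = x \<otimes> m" using less.prems by (auto simp: adjoin_def)
      then have "m \<in> carrier G" using less.prems subgroup_subset by blast
      then have "x = e \<otimes> inv m" using m x by (simp add: m_assoc)
      then show False using x m less.prems by (auto simp: adjoin_def subgroup.m_inv_closed)
    qed
    have "card (carrier G - adjoin M x) < card (carrier G - M)"
      using card_diff_adjoin_less less.prems x xM subgroup_subset by blast
    moreover have "subgroup (adjoin M x) G" using subgroup_adjoin less.prems x by blast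
    ultimately obtain xs where
      "tower (adjoin M x) (xs @ [e])" "span (adjoin M x) (xs @ [e]) = carrier G"
      using less.hyps[of "adjoin M x"] less.prems e adjoin_mono by blast
    then show ?thesis using x xM less.prems by (intro exI[of _ "x # xs"]) simp
  qed
qed

end

section \<open>Pairs of simultaneous bases\<close>

context comm_group
begin

text \<open>
  The cardinality condition makes the representation of an element of \<open>L\<close> unique in each of the
  four coverings.
\<close>

definition pair_basis :: "'a set \<Rightarrow> 'a set \<Rightarrow> ('a \<times> 'a) list \<Rightarrow> bool"
  where "pair_basis K L ps \<longleftrightarrow>
    set ps \<subseteq> carrier G \<times> carrier G \<and> card L = 2 ^ length ps * card K \<and>
    span K (map fst ps) = L \<and> span K (map snd ps) = L \<and>
    span K (map (\<lambda>(a, b). a \<otimes> b) ps) = L \<and> span K (map (\<lambda>(a, b). a \<otimes> inv b) ps) = L"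

lemma pair_basis_append:
  "pair_basis K L ps \<Longrightarrow> pair_basis L N qs \<Longrightarrow> pair_basis K N (ps @ qs)"
  by (auto simp: pair_basis_def power_add)

text \<open>
  Each element is multiplied by its predecessor, which the current subgroup already contains;
  \<open>a\<close> serves as the predecessor of the first one.
\<close>

lemma span_consecutive_products:
  assumes "subgroup M G" "tower M xs" "a \<in> M"
  shows "span M (map (\<lambda>(a, b). a \<otimes> b) (zip (a # xs) xs)) = span M xs"
  using assms
proof (induction xs arbitrary: M a)
  case (Cons x xs)
  then have "adjoin M (a \<otimes> x) = adjoin M x" by (simp add: adjoin_absorb)
  then show ?case using Cons by (simp add: subgroup_adjoin mem_adjoin)
qed simp

lemma span_consecutive_quotients:
  assumes "subgroup M G" "tower M xs" "a \<in> M"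
  shows "span M (map (\<lambda>(a, b). a \<otimes> inv b) (zip (a # xs) xs)) = span M xs"
  using assms
proof (induction xs arbitrary: M a)
  case (Cons x xs)
  then have "adjoin M (a \<otimes> inv x) = adjoin M x" by (simp add: adjoin_absorb adjoin_inv)
  then show ?case using Cons by (simp add: subgroup_adjoin mem_adjoin)
qed simp

lemma zip_shift: "zip (x # ys) (ys @ [z]) = zip (x # ys) ys @ [(last (x # ys), z)]"
  by (induction ys arbitrary: x) auto

text \<open>
  With \<open>a = (x, \<dots>, e)\<close> and its shift \<open>b = (\<dots>, e, e x)\<close>, the last entry of \<open>a b\<close> is \<open>e\<^sup>2 x\<close> and
  that of \<open>a b\<inverse>\<close> is \<open>x\<inverse>\<close>. Over \<open>K\<close> both are as good as \<open>x\<close>, and after them the other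
  entries climb the same chain as the tower does.
\<close>

lemma pair_basis_shift:
  assumes K: "subgroup K G" "finite K" and t: "tower K (x # xs @ [e])" and e: "e \<otimes> e \<in> K"
  shows "pair_basis K (span K (x # xs @ [e])) (zip (x # xs @ [e]) (xs @ [e, e \<otimes> x]))"
proof -
  interpret K: subgroup K G by (rule K)
  let ?xs = "xs @ [e]"
  let ?L = "span K (x # ?xs)"
  define ps where "ps = zip (x # ?xs) (?xs @ [e \<otimes> x])"
  have ps: "ps = zip (x # ?xs) ?xs @ [(e, e \<otimes> x)]"
    unfolding ps_def zip_shift by simp
  have c: "x \<in> carrier G" "e \<in> carrier G" "set xs \<subseteq> carrier G"
    using tower_carrier[OF t] by auto
  have xx: "x \<otimes> x \<in> K" and t': "tower (adjoin K x) ?xs" using t by auto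
  have K1: "subgroup (adjoin K x) G" "x \<in> adjoin K x"
    using c xx K by (auto simp: subgroup_adjoin mem_adjoin)
  have fst: "map fst ps = x # ?xs" and snd: "map snd ps = ?xs @ [e \<otimes> x]"
    by (simp_all add: ps_def)
  have zc: "set (zip (x # ?xs) ?xs) \<subseteq> carrier G \<times> carrier G"
  proof
    fix p assume "p \<in> set (zip (x # ?xs) ?xs)"
    then have "fst p \<in> set (x # ?xs)" "snd p \<in> set ?xs"
      by (metis prod.collapse set_zip_leftD set_zip_rightD)+
    then show "p \<in> carrier G \<times> carrier G" using c by (cases p) auto
  qed
  have Ke: "subgroup (adjoin K e) G" using c e K by (simp add: subgroup_adjoin)
  \<comment> \<open>The pairs \<open>e, e x\<close> and \<open>x, e\<close> have the same span over \<open>K\<close>, because \<open>e\<^sup>2 \<in> K\<close>.\<close>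
  have "span K (?xs @ [e \<otimes> x]) = span (adjoin (adjoin K e) (e \<otimes> x)) xs"
    using c K.subset by (simp add: adjoin_span adjoin_closed)
  also have "adjoin (adjoin K e) (e \<otimes> x) = adjoin (adjoin K x) e"
    using adjoin_absorb[OF Ke c(1) mem_adjoin[OF K(1) c(2)]] adjoin_commute[OF K.subset c(1,2)] by simp
  also have "span \<dots> xs = ?L"
    using c K.subset by (simp add: adjoin_span adjoin_closed)
  finally have 2: "span K (map snd ps) = ?L" by (simp only: snd)
  \<comment> \<open>The last entry is moved to the front, where it leads from \<open>K\<close> to \<open>adjoin K x\<close>.\<close>
  have last: "span K (map f (zip (x # ?xs) ?xs) @ [z]) = span (adjoin K z) (map f (zip (x # ?xs) ?xs))"
    if "z \<in> carrier G" "\<And>a b. a \<in> carrier G \<Longrightarrow> b \<in> carrier G \<Longrightarrow> f (a, b) \<in> carrier G"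
    for f z
    using that zc K.subset by (simp, subst adjoin_span) auto
  have "e \<otimes> (e \<otimes> x) = (e \<otimes> e) \<otimes> x" using c by (simp add: m_assoc)
  then have "adjoin K (e \<otimes> (e \<otimes> x)) = adjoin K x"
    using adjoin_absorb[OF K(1) c(1) e] by simp
  then have 3: "span K (map (\<lambda>(a, b). a \<otimes> b) ps) = ?L"
    using last[of "e \<otimes> (e \<otimes> x)" "\<lambda>(a, b). a \<otimes> b"] c
      span_consecutive_products[OF K1(1) t' K1(2)] by (simp add: ps)
  have "e \<otimes> inv (e \<otimes> x) = inv x" using c by (simp add: inv_mult m_assoc[symmetric])
  then have 4: "span K (map (\<lambda>(a, b). a \<otimes> inv b) ps) = ?L"
    using last[of "inv x" "\<lambda>(a, b). a \<otimes> inv b"] c adjoin_inv[OF K(1) c(1) xx]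
      span_consecutive_quotients[OF K1(1) t' K1(2)] by (simp add: ps)
  have "length ps = length (x # ?xs)" by (simp add: ps_def)
  then have "card ?L = 2 ^ length ps * card K" using card_span[OF K t] by (simp only:)
  moreover have "set ps \<subseteq> carrier G \<times> carrier G" using zc c by (simp add: ps)
  ultimately have "pair_basis K ?L ps"
    unfolding pair_basis_def using fst 2 3 4 by (simp only:)
  then show ?thesis by (simp add: ps_def)
qed

lemma subgroup_squares:
  assumes K: "subgroup K G"
  shows "subgroup {k \<otimes> (x \<otimes> x) |k x. k \<in> K \<and> x \<in> carrier G} G" (is "subgroup ?B G")
proof -
  interpret K: subgroup K G by (rule K)
  show ?thesis
  proof (rule subgroupI)
    show "?B \<subseteq> carrier G" by auto
    have "\<one> \<otimes> (\<one> \<otimes> \<one>) \<in> ?B" using K.one_closed one_closed by blast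
    then show "?B \<noteq> {}" by blast
  next
    fix a assume "a \<in> ?B"
    then obtain k x where a: "a = k \<otimes> (x \<otimes> x)" "k \<in> K" "x \<in> carrier G" by auto
    then have "inv a = inv k \<otimes> (inv x \<otimes> inv x)" by (simp add: inv_mult)
    then show "inv a \<in> ?B" using a K.m_inv_closed inv_closed by blast
  next
    fix a b assume "a \<in> ?B" "b \<in> ?B"
    then obtain k x l y where a: "a = k \<otimes> (x \<otimes> x)" "k \<in> K" "x \<in> carrier G"
      "b = l \<otimes> (y \<otimes> y)" "l \<in> K" "y \<in> carrier G" by auto
    then have "a \<otimes> b = (k \<otimes> l) \<otimes> ((x \<otimes> y) \<otimes> (x \<otimes> y))" by (simp add: m_ac)
    then show "a \<otimes> b \<in> ?B" using a K.m_closed m_closed by blast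
  qed
qed

text \<open>
  The cosets of \<open>u\<close> and \<open>v\<close> generate a Klein four-group in \<open>G / K\<close>. The last condition, that
  \<open>u v \<notin> K\<close>, says that they are distinct involutions, since \<open>v\<^sup>2 \<in> K\<close>.
\<close>

definition independent_involutions_mod :: "'a set \<Rightarrow> 'a \<Rightarrow> 'a \<Rightarrow> bool"
  where "independent_involutions_mod K u v \<longleftrightarrow> u \<in> carrier G \<and> v \<in> carrier G \<and>
    u \<otimes> u \<in> K \<and> v \<otimes> v \<in> K \<and> u \<notin> K \<and> v \<notin> K \<and> u \<otimes> v \<notin> K"

end

section \<open>Every noncyclic abelian 2-group has a pair basis\<close>

context comm_2_group
begin

text \<open>
  Let \<open>B\<close> be the subgroup of the squares modulo \<open>K\<close>. As \<open>G / B\<close> has exponent two, a tower from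
  \<open>K\<close> to \<open>B\<close> extends to a tower up to \<open>G\<close> that ends with \<open>e\<close>, and the shift applies. The
  elements \<open>u\<close> and \<open>v\<close> are there to exclude \<open>[G : K] = 2\<close>, where the tower would consist of
  \<open>e\<close> alone and would have no separate first element.
\<close>

lemma ex_pair_basis_if_nonsquare_involution:
  assumes K: "subgroup K G" and w: "independent_involutions_mod K u v"
    and e: "e \<in> carrier G" "e \<otimes> e \<in> K" "\<nexists>k x. k \<in> K \<and> x \<in> carrier G \<and> e = k \<otimes> (x \<otimes> x)"
  shows "\<exists>ps. pair_basis K (carrier G) ps"
proof -
  interpret K: subgroup K G by (rule K)
  define B where "B = {k \<otimes> (x \<otimes> x) |k x. k \<in> K \<and> x \<in> carrier G}"
  have B: "subgroup B G" unfolding B_def by (rule subgroup_squares[OF K])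
  have "K \<subseteq> B"
  proof
    fix k assume "k \<in> K"
    then have "k = k \<otimes> (\<one> \<otimes> \<one>)" by simp
    then show "k \<in> B" unfolding B_def using \<open>k \<in> K\<close> by blast
  qed
  then obtain xs where xs: "tower K xs" "span K xs = B" using ex_tower[OF K B] by blast
  have sq: "x \<otimes> x \<in> B" if "x \<in> carrier G" for x
  proof -
    have "x \<otimes> x = \<one> \<otimes> (x \<otimes> x)" using that by simp
    then show ?thesis unfolding B_def using that K.one_closed by blast
  qed
  have "e \<notin> B" using e(3) by (auto simp: B_def)
  then obtain ys where "tower B (ys @ [e])" "span B (ys @ [e]) = carrier G"
    using ex_tower_to_complement[OF B sq e(1)] by blast
  then have t: "tower K ((xs @ ys) @ [e])" "span K ((xs @ ys) @ [e]) = carrier G"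
    using xs by (simp_all add: tower_append)
  show ?thesis
  proof (cases "xs @ ys")
    case Nil
    then have *: "adjoin K e = carrier G" and eK: "e \<notin> K" using t by auto
    have "u \<in> adjoin K e" "v \<in> adjoin K e" "u \<notin> K" "v \<notin> K"
      unfolding * using w by (auto simp: independent_involutions_mod_def)
    then obtain k l where kl: "k \<in> K" "u = e \<otimes> k" "l \<in> K" "v = e \<otimes> l"
      by (auto simp: adjoin_def)
    then have "u \<otimes> v = (e \<otimes> e) \<otimes> (k \<otimes> l)" using e by (simp add: m_ac)
    then have "u \<otimes> v \<in> K" using e kl by simp
    then show ?thesis using w by (simp add: independent_involutions_mod_def)
  next
    case (Cons z zs)
    then have "tower K (z # zs @ [e])" "span K (z # zs @ [e]) = carrier G"
      using t by (simp_all only: append_Cons)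
    then show ?thesis using pair_basis_shift[OF K subgroup_finite[OF K] _ e(2)] by metis
  qed
qed

text \<open>
  In the inductive step all elements of \<open>V = \<langle>K, u, v\<rangle>\<close> have their squares in \<open>K\<close>. Hence none of
  \<open>x\<close>, \<open>y\<close>, \<open>x y\<close> lies in \<open>V\<close>: their squares are \<open>u\<close>, \<open>v\<close>, \<open>u v\<close> modulo \<open>K\<close>.
\<close>

lemma ex_pair_basis:
  assumes "subgroup K G" "independent_involutions_mod K u v"
  shows "\<exists>ps. pair_basis K (carrier G) ps"
  using assms
proof (induction "card (carrier G - K)" arbitrary: K u v rule: less_induct)
  case less
  interpret K: subgroup K G by (rule less.prems)
  have w: "u \<in> carrier G" "v \<in> carrier G" "u \<otimes> u \<in> K" "v \<otimes> v \<in> K"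
    "u \<notin> K" "v \<notin> K" "u \<otimes> v \<notin> K"
    using less.prems(2) unfolding independent_involutions_mod_def by auto
  show ?case
  proof (cases "\<exists>e\<in>carrier G. e \<otimes> e \<in> K \<and> (\<nexists>k x. k \<in> K \<and> x \<in> carrier G \<and> e = k \<otimes> (x \<otimes> x))")
    case True
    then obtain e where "e \<in> carrier G" "e \<otimes> e \<in> K"
      "\<nexists>k x. k \<in> K \<and> x \<in> carrier G \<and> e = k \<otimes> (x \<otimes> x)"
      by (elim bexE conjE)
    then show ?thesis by (rule ex_pair_basis_if_nonsquare_involution[OF less.prems])
  next
    case False
    then have sq: "\<exists>k x. k \<in> K \<and> x \<in> carrier G \<and> e = k \<otimes> (x \<otimes> x)"
      if "e \<in> carrier G" "e \<otimes> e \<in> K" for e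
      using that by blast
    obtain k x where x: "k \<in> K" "x \<in> carrier G" "u = k \<otimes> (x \<otimes> x)" using sq[of u] w by blast
    obtain l y where y: "l \<in> K" "y \<in> carrier G" "v = l \<otimes> (y \<otimes> y)" using sq[of v] w by blast
    have v: "v \<notin> adjoin K u"
    proof
      assume "v \<in> adjoin K u"
      then obtain m where m: "m \<in> K" "v = u \<otimes> m" using w by (auto simp: adjoin_def)
      then have "u \<otimes> v = (u \<otimes> u) \<otimes> m" using w(1) by (simp add: m_assoc)
      also have "\<dots> \<in> K" using w(3) m(1) by (rule K.m_closed)
      finally show False using w(7) by blast
    qed
    define V where "V = adjoin (adjoin K u) v"
    have KV: "K \<subseteq> V" unfolding V_def using adjoin_mono by blast
    have t: "tower K [u, v]" using w v adjoin_mono by auto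
    have V: "subgroup V G" using subgroup_span[OF less.prems(1) t] by (simp add: V_def)
    have ps: "pair_basis K V (zip [u, v] [v, v \<otimes> u])"
      using pair_basis_shift[OF less.prems(1) subgroup_finite[OF less.prems(1)], of u "[]" v] t w(4)
      by (simp only: append_Nil foldl.simps V_def)
    have sqV: "z \<otimes> z \<in> K" if z: "z \<in> V" for z
    proof -
      have *: "adjoin (adjoin K u) v = K \<union> (\<lambda>m. u \<otimes> m) ` K \<union> ((\<lambda>m. v \<otimes> m) ` K \<union> (\<lambda>m. v \<otimes> (u \<otimes> m)) ` K)"
        by (simp only: adjoin_def image_Un image_image)
      obtain m a where m: "m \<in> K" "z = a \<otimes> m" "a \<in> carrier G" "a \<otimes> a \<in> K"
      proof -
        have vu: "v \<otimes> u \<in> carrier G" "v \<otimes> u \<otimes> (v \<otimes> u) = (v \<otimes> v) \<otimes> (u \<otimes> u)"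
          using w(1,2) by (simp_all add: m_ac)
        from z show ?thesis unfolding V_def *
        proof (elim UnE imageE)
          assume "z \<in> K" then show ?thesis using that[of z \<one>] by simp
        next
          fix m assume "z = u \<otimes> m" "m \<in> K" then show ?thesis using that w(1-4) by blast
        next
          fix m assume "z = v \<otimes> m" "m \<in> K" then show ?thesis using that w(1-4) by blast
        next
          fix m assume "z = v \<otimes> (u \<otimes> m)" "m \<in> K"
          then have "z = v \<otimes> u \<otimes> m" using w(1,2) by (simp add: m_assoc)
          moreover have "v \<otimes> u \<otimes> (v \<otimes> u) \<in> K" unfolding vu using w(3,4) by simp
          ultimately show ?thesis using that \<open>m \<in> K\<close> vu(1) by blast
        qed
      qed
      have "z \<otimes> z = (a \<otimes> a) \<otimes> (m \<otimes> m)" using m by (simp add: m_ac)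
      then show ?thesis using m by simp
    qed
    have inV: "u \<in> V" "v \<in> V"
    proof -
      have Ku: "subgroup (adjoin K u) G" using less.prems(1) w(1,3) by (rule subgroup_adjoin)
      show "v \<in> V" unfolding V_def using Ku w(2) by (rule mem_adjoin)
      show "u \<in> V" unfolding V_def using mem_adjoin[OF less.prems(1) w(1)] adjoin_mono by blast
    qed
    have eq: "x \<otimes> x = inv k \<otimes> u" "y \<otimes> y = inv l \<otimes> v"
      unfolding x(3) y(3) using x(1,2) y(1,2) by (simp_all add: m_assoc[symmetric])
    have "independent_involutions_mod V x y"
      unfolding independent_involutions_mod_def
    proof (intro conjI notI)
      show "x \<in> carrier G" "y \<in> carrier G" by fact+
      show "x \<otimes> x \<in> V" "y \<otimes> y \<in> V"
        unfolding eq using x(1) y(1) inV KV by (auto intro!: subgroup.m_closed[OF V])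
    next
      assume "x \<in> V"
      then have "u \<in> K" unfolding x(3) by (intro K.m_closed x sqV)
      then show False using w(5) by blast
    next
      assume "y \<in> V"
      then have "v \<in> K" unfolding y(3) by (intro K.m_closed y sqV)
      then show False using w(6) by blast
    next
      assume "x \<otimes> y \<in> V"
      then have "(x \<otimes> y) \<otimes> (x \<otimes> y) \<in> K" by (rule sqV)
      then have "(k \<otimes> l) \<otimes> ((x \<otimes> y) \<otimes> (x \<otimes> y)) \<in> K" using x(1) y(1) by simp
      also have "(k \<otimes> l) \<otimes> ((x \<otimes> y) \<otimes> (x \<otimes> y)) = u \<otimes> v"
        unfolding x(3) y(3) using x(1,2) y(1,2) by (simp add: m_ac)
      finally show False using w(7) by blast
    qed
    moreover have "card (carrier G - V) < card (carrier G - K)"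
      using finite_carrier KV inV w by (intro psubset_card_mono) auto
    ultimately obtain qs where "pair_basis V (carrier G) qs" using less.hyps V by blast
    then show ?thesis using ps pair_basis_append by blast
  qed
qed

text \<open>
  Let \<open>\<langle>g\<rangle>\<close> be a largest cyclic subgroup and \<open>x \<notin> \<langle>g\<rangle>\<close> with \<open>x\<^sup>2 = g\<^sup>t\<close>. For odd \<open>t\<close> the
  element \<open>g\<close> would be a power of \<open>x\<close>, so that \<open>\<langle>x\<rangle>\<close> would be larger. Hence \<open>t = 2 s\<close>, and
  \<open>x g\<^sup>-\<^sup>s\<close> is an involution outside \<open>\<langle>g\<rangle>\<close>. A second one lies in \<open>\<langle>g\<rangle>\<close>.
\<close>

lemma ex_two_involutions:
  assumes "\<not> cyclic_group G"
  shows "\<exists>u v. independent_involutions_mod {\<one>} u v"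
proof -
  define cyc where "cyc x = range (\<lambda>i::int. x [^] i)" for x
  have sub: "subgroup (cyc x) G" if "x \<in> carrier G" for x
    unfolding cyc_def using generate_pow[OF that] generate_is_subgroup[of "{x}"] that
    by (simp add: full_SetCompr_eq)
  have self: "x \<in> cyc x" if "x \<in> carrier G" for x
    unfolding cyc_def using that by (intro image_eqI[of _ _ 1]) auto
  have "finite ((\<lambda>x. card (cyc x)) ` carrier G)" using finite_carrier by simp
  moreover have "(\<lambda>x. card (cyc x)) ` carrier G \<noteq> {}" using one_closed by blast
  ultimately obtain g where g: "g \<in> carrier G"
    and max: "\<And>x. x \<in> carrier G \<Longrightarrow> card (cyc x) \<le> card (cyc g)"
    using Max_in[of "(\<lambda>x. card (cyc x)) ` carrier G"] Max_ge[of "(\<lambda>x. card (cyc x)) ` carrier G"]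
    by (smt (verit) imageE imageI)
  \<comment> \<open>Otherwise \<open>cyc x\<close> would properly contain \<open>cyc g\<close>.\<close>
  have no: "g \<notin> cyc x" if x: "x \<in> carrier G" "x \<notin> cyc g" for x
  proof
    assume "g \<in> cyc x"
    then have "generate G {g} \<subseteq> cyc x" using generate_subgroup_incl sub x by simp
    then have "cyc g \<subset> cyc x"
      using x self generate_pow[OF g] by (auto simp: cyc_def full_SetCompr_eq)
    with subgroup_finite[OF sub[OF x(1)]] have "card (cyc g) < card (cyc x)"
      by (rule psubset_card_mono)
    then show False using max[OF x(1)] by simp
  qed
  have "cyc g \<noteq> carrier G" using assms g cyclic_group by (auto simp: cyc_def)
  then have "cyc g \<subset> carrier G" using subgroup_subset[OF sub[OF g]] by blast
  then obtain x where x: "x \<in> carrier G" "x \<notin> cyc g" "x \<otimes> x \<in> cyc g"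
    using bexE[OF ex_square_into_smaller[OF sub[OF g] subgroup_self]] by metis
  then obtain t :: int where t: "x \<otimes> x = g [^] t" by (auto simp: cyc_def)
  have "even t"
  proof (rule ccontr)
    assume "odd t"
    then have "coprime t (2 ^ n)" by simp
    then obtain a b where ab: "a * t + b * 2 ^ n = 1"
      using bezout_int[of t "2 ^ n"] by (auto simp: coprime_iff_gcd_eq_1)
    have g1: "g [^] (2 ^ n :: int) = \<one>"
      using pow_2_n[OF g] by (metis int_pow_int of_nat_numeral of_nat_power)
    have "g = g [^] (t * a + 2 ^ n * b)" using ab g by (simp add: mult.commute[of t] mult.commute[of "2 ^ n"])
    also have "\<dots> = (g [^] t) [^] a \<otimes> (g [^] (2 ^ n :: int)) [^] b"
      using g by (simp add: int_pow_mult int_pow_pow)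
    also have "\<dots> = (x \<otimes> x) [^] a" using g x g1 t by simp
    also have "\<dots> = x [^] a \<otimes> x [^] a" using x by (simp add: int_pow_mult_distrib)
    also have "\<dots> = x [^] (a + a)" using x(1) by (simp only: int_pow_mult)
    finally have "g \<in> cyc x" by (auto simp: cyc_def)
    then show False using no x by blast
  qed
  then obtain s where s: "t = s + s" by (auto elim: evenE)
  define u where "u = x \<otimes> inv (g [^] s)"
  have u: "u \<in> carrier G" "u \<notin> cyc g"
  proof -
    show "u \<in> carrier G" using x g by (simp add: u_def)
    have "x = u \<otimes> g [^] s" using x g by (simp add: u_def m_assoc)
    then show "u \<notin> cyc g"
      using x(2) subgroup.m_closed[OF sub[OF g], of u "g [^] s"] by (metis cyc_def rangeI)
  qed
  have "u \<otimes> u = (x \<otimes> x) \<otimes> inv (g [^] s \<otimes> g [^] s)"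
    using x g by (simp add: u_def inv_mult m_ac)
  moreover have "x \<otimes> x = g [^] s \<otimes> g [^] s" using t g unfolding s by (simp only: int_pow_mult)
  ultimately have uu: "u \<otimes> u = \<one>" using g by simp
  have one: "\<one> \<in> cyc y" if "y \<in> carrier G" for y using sub[OF that] subgroup.one_closed by blast
  have "g \<noteq> \<one>" using no x one by blast
  then have "{\<one>} \<subset> cyc g" using one self g by blast
  then obtain v where v: "v \<in> cyc g" "v \<noteq> \<one>" "v \<otimes> v = \<one>"
    using ex_square_into_smaller[OF triv_subgroup sub[OF g]] by blast
  have vc: "v \<in> carrier G" using v sub g subgroup_subset by blast
  have "u \<otimes> v \<noteq> \<one>"
  proof
    assume "u \<otimes> v = \<one>"
    then have "u = inv v" using inv_equality u(1) vc by metis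
    then show False using u(2) subgroup.m_inv_closed[OF sub[OF g] v(1)] by simp
  qed
  then show ?thesis unfolding independent_involutions_mod_def using u uu v vc one g by blast
qed

end

section \<open>From bases to difference matrices\<close>

context comm_group
begin

lemma span_products:
  assumes "set ds \<subseteq> carrier G" "g \<in> span {\<one>} ds"
  shows "\<exists>c\<in>tuples 2 (length ds). g = (\<Otimes>j\<in>{..<length ds}. (ds ! j) [^] c j)"
  using assms
proof (induction ds arbitrary: g rule: rev_induct)
  case Nil
  then show ?case by (auto simp: tuples_def)
next
  case (snoc d ds)
  let ?n = "length ds"
  obtain h b where hb: "h \<in> span {\<one>} ds" "b < (2::nat)" "g = d [^] b \<otimes> h"
  proof -
    have d: "d \<in> carrier G" "span {\<one>} ds \<subseteq> carrier G"
      using snoc.prems(1) span_closed[of "{\<one>}" ds] by auto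
    have "g \<in> adjoin (span {\<one>} ds) d" using snoc.prems(2) by simp
    then consider "g \<in> span {\<one>} ds" | m where "m \<in> span {\<one>} ds" "g = d \<otimes> m"
      by (auto simp: adjoin_def)
    then show ?thesis
    proof cases
      case 1
      then have "g = d [^] (0::nat) \<otimes> g" using d by auto
      then show ?thesis using that[of g 0] 1 by simp
    next
      case 2
      then have "g = d [^] (1::nat) \<otimes> m" using d by simp
      then show ?thesis using that[of m 1] 2 by simp
    qed
  qed
  then obtain c where c: "c \<in> tuples 2 ?n" "h = (\<Otimes>j\<in>{..<?n}. (ds ! j) [^] c j)"
    using snoc.IH[OF _ hb(1)] snoc.prems(1) by auto
  have dsc: "ds ! j \<in> carrier G" if "j < ?n" for j using snoc.prems that by auto
  have eq: "(\<Otimes>j\<in>{..<?n}. ((ds @ [d]) ! j) [^] (c(?n := b)) j) = h"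
    unfolding c(2) using dsc by (rule_tac finprod_cong') (auto simp: nth_append)
  have "(\<Otimes>j\<in>{..<Suc ?n}. ((ds @ [d]) ! j) [^] (c(?n := b)) j) = d [^] b \<otimes> h"
    unfolding lessThan_Suc eq[symmetric] using dsc snoc.prems
    by (subst finprod_insert) (auto simp: nth_append)
  moreover have "c(?n := b) \<in> tuples 2 (Suc ?n)"
    using c(1) hb(2) by (auto simp: tuples_def PiE_def Pi_def extensional_def)
  ultimately show ?case
    unfolding length_append_singleton hb(3)
    by (intro bexI[of _ "c(?n := b)"]) (simp_all only:)
qed

lemma card_tuples: "card (tuples p k) = p ^ k"
  by (simp add: tuples_def card_PiE)

lemma finite_tuples: "finite (tuples p k)"
  by (simp add: tuples_def finite_PiE)

text \<open>A covering by \<open>2\<^sup>n\<close> subproducts of a group of order \<open>2\<^sup>n\<close> has no repetitions.\<close>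

lemma bij_betw_products:
  assumes ds: "set ds \<subseteq> carrier G" and span: "span {\<one>} ds = carrier G"
    and card: "card (carrier G) = 2 ^ length ds"
  shows "bij_betw (\<lambda>c. \<Otimes>j\<in>{..<length ds}. (ds ! j) [^] c j) (tuples 2 (length ds)) (carrier G)"
    (is "bij_betw ?f ?C _")
proof -
  have "ds ! j \<in> carrier G" if "j < length ds" for j using ds that by auto
  then have "?f ` ?C \<subseteq> carrier G" by (auto intro!: finprod_closed)
  moreover have "carrier G \<subseteq> ?f ` ?C" using span_products[OF ds] span by blast
  ultimately have im: "?f ` ?C = carrier G" by blast
  then have "inj_on ?f ?C" using card by (intro eq_card_imp_inj_on) (auto simp: finite_tuples card_tuples)
  with im show ?thesis by (simp add: bij_betw_def)
qed

lemma card_fibre_bij: "bij_betw f C D \<Longrightarrow> g \<in> D \<Longrightarrow> card {c \<in> C. f c = g} = 1"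
proof -
  assume f: "bij_betw f C D" and g: "g \<in> D"
  then obtain c where "c \<in> C" "f c = g" by (auto simp: bij_betw_def)
  then have "{c \<in> C. f c = g} = {c}" using f by (auto simp: bij_betw_def inj_on_def)
  then show ?thesis by simp
qed

lemma expansion_two_rows:
  assumes "\<And>i j. i < 2 \<Longrightarrow> j < l \<Longrightarrow> M i j \<in> carrier G"
  shows "expansion G 2 l M r c =
    (\<Otimes>j\<in>{..<l}. (M 0 j [^] r 0 \<otimes> M 1 j [^] r 1) [^] c j)"
proof -
  have split: "{..<2} \<times> {..<l} = Pair 0 ` {..<l} \<union> Pair (1::nat) ` {..<l}" by (auto simp: less_2_cases_iff)
  let ?f = "\<lambda>(i, j). M i j [^] (r i * c j)"
  have cl: "M 0 j \<in> carrier G" "M 1 j \<in> carrier G" "M (Suc 0) j \<in> carrier G" if "j < l" for j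
    using assms that by auto
  have "expansion G 2 l M r c = finprod G ?f (Pair 0 ` {..<l}) \<otimes> finprod G ?f (Pair 1 ` {..<l})"
    unfolding expansion_def split using cl by (intro finprod_Un_disjoint) auto
  also have "\<dots> = (\<Otimes>j\<in>{..<l}. M 0 j [^] (r 0 * c j)) \<otimes> (\<Otimes>j\<in>{..<l}. M 1 j [^] (r 1 * c j))"
    using cl by (subst (1 2) finprod_reindex) (auto simp: inj_on_def)
  also have "\<dots> = (\<Otimes>j\<in>{..<l}. M 0 j [^] (r 0 * c j) \<otimes> M 1 j [^] (r 1 * c j))"
    using cl by (intro finprod_multf[symmetric]) auto
  also have "\<dots> = (\<Otimes>j\<in>{..<l}. (M 0 j [^] r 0 \<otimes> M 1 j [^] r 1) [^] c j)"
    using cl by (intro finprod_cong') (auto simp: nat_pow_pow pow_mult_distrib m_comm)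
  finally show ?thesis .
qed

lemma finprod_quotient:
  assumes "f \<in> A \<rightarrow> carrier G" "h \<in> A \<rightarrow> carrier G"
  shows "finprod G f A \<otimes> inv (finprod G h A) = (\<Otimes>j\<in>A. f j \<otimes> inv (h j))"
proof -
  have "(\<Otimes>j\<in>A. f j \<otimes> inv (h j)) \<otimes> finprod G h A = (\<Otimes>j\<in>A. f j \<otimes> inv (h j) \<otimes> h j)"
    using assms by (intro finprod_multf[symmetric]) auto
  also have "\<dots> = finprod G f A"
    using assms by (intro finprod_cong') (auto simp: m_assoc Pi_def)
  finally have eq: "finprod G f A = (\<Otimes>j\<in>A. f j \<otimes> inv (h j)) \<otimes> finprod G h A" by (rule sym)
  have "(\<Otimes>j\<in>A. f j \<otimes> inv (h j)) \<in> carrier G" "finprod G h A \<in> carrier G"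
    using assms by (auto intro!: finprod_closed simp: Pi_def)
  then show ?thesis unfolding eq by (simp only: m_assoc inv_closed r_inv r_one)
qed

text \<open>
  The quotient of the rows \<open>r\<close> and \<open>s\<close> of the expansion runs through the subproducts of the
  sequence with entries \<open>f (a\<^sub>j, b\<^sub>j)\<close>, where \<open>f (a, b)\<close> is \<open>a\<close> to the power \<open>r\<^sub>0 - s\<^sub>0\<close> times
  \<open>b\<close> to the power \<open>r\<^sub>1 - s\<^sub>1\<close>. For \<open>r \<noteq> s\<close>, up to inversion,
  \<open>f (a, b)\<close> is one of \<open>a\<close>, \<open>b\<close>, \<open>a b\<close>, \<open>a b\<inverse>\<close>.
\<close>

lemma contracted_of_pair_basis:
  assumes ps: "pair_basis {\<one>} (carrier G) ps" and nt: "carrier G \<noteq> {\<one>}"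
  shows "\<exists>M. contracted_difference_matrix 2 G 2 0 M"
proof -
  define l where "l = length ps"
  define M where "M i j = (if i = 0 then fst (ps ! j) else snd (ps ! j))" for i j :: nat
  have card: "card (carrier G) = 2 ^ l" using ps by (simp add: pair_basis_def l_def)
  then have fin: "finite (carrier G)" by (metis card.infinite power_not_zero zero_neq_numeral)
  have M: "M i j \<in> carrier G" if "j < l" for i j
  proof -
    have "ps ! j \<in> carrier G \<times> carrier G"
      using ps nth_mem[of j ps] that unfolding pair_basis_def l_def by blast
    then show ?thesis by (auto simp: M_def)
  qed
  let ?D = "\<lambda>r s c. expansion G 2 l M r c \<otimes> inv (expansion G 2 l M s c)"
  have ex_cl: "expansion G 2 l M r c \<in> carrier G" for r c
    using M by (subst expansion_two_rows) (auto intro!: finprod_closed)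
  have D: "?D r s c = (\<Otimes>j\<in>{..<l}. (f (ps ! j)) [^] c j)"
    if f0: "\<And>a b. a \<in> carrier G \<Longrightarrow> b \<in> carrier G \<Longrightarrow>
      f (a, b) = (a [^] r 0 \<otimes> b [^] r 1) \<otimes> inv (a [^] s 0 \<otimes> b [^] s 1)" for f r s and c :: "nat \<Rightarrow> nat"
  proof -
    have f: "f (ps ! j) = (M 0 j [^] r 0 \<otimes> M 1 j [^] r 1) \<otimes> inv (M 0 j [^] s 0 \<otimes> M 1 j [^] s 1)"
      if j: "j < l" for j
      using f0[of "fst (ps ! j)" "snd (ps ! j)"] M[OF j, of 0] M[OF j, of 1] by (simp add: M_def)
    have "?D r s c = (\<Otimes>j\<in>{..<l}. (M 0 j [^] r 0 \<otimes> M 1 j [^] r 1) [^] c j \<otimes>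
      inv ((M 0 j [^] s 0 \<otimes> M 1 j [^] s 1) [^] c j))"
      using M by (simp add: expansion_two_rows finprod_quotient)
    also have "\<dots> = (\<Otimes>j\<in>{..<l}. (f (ps ! j)) [^] c j)"
      using M by (intro finprod_cong') (auto simp: f pow_mult_distrib m_comm nat_pow_inv)
    finally show ?thesis .
  qed
  have bij: "bij_betw (?D r s) (tuples 2 l) (carrier G)"
    if f: "\<And>a b. a \<in> carrier G \<Longrightarrow> b \<in> carrier G \<Longrightarrow>
      f (a, b) = (a [^] r 0 \<otimes> b [^] r 1) \<otimes> inv (a [^] s 0 \<otimes> b [^] s 1)"
      and sp: "span {\<one>} (map f ps) = carrier G" for f r s
  proof -
    have "set (map f ps) \<subseteq> carrier G" using ps f by (auto simp: pair_basis_def)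
    from bij_betw_products[OF this sp] card
    have "bij_betw (\<lambda>c. \<Otimes>j\<in>{..<l}. (map f ps ! j) [^] c j) (tuples 2 l) (carrier G)"
      by (simp add: l_def)
    moreover have "(\<Otimes>j\<in>{..<l}. (map f ps ! j) [^] c j) = ?D r s c" for c :: "nat \<Rightarrow> nat"
    proof -
      have "f (ps ! j) \<in> carrier G" if "j < l" for j
        using f[of "fst (ps ! j)" "snd (ps ! j)"] M[OF that, of 0] M[OF that, of 1] by (simp add: M_def)
      then have "(\<Otimes>j\<in>{..<l}. (map f ps ! j) [^] c j) = (\<Otimes>j\<in>{..<l}. f (ps ! j) [^] c j)"
        by (rule_tac finprod_cong') (auto simp: l_def)
      also have "\<dots> = ?D r s c" by (rule D[symmetric]) (rule f)
      finally show ?thesis .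
    qed
    ultimately show ?thesis by simp
  qed
  have tup: "r 0 < 2 \<and> r 1 < 2" if "r \<in> tuples 2 2" for r
    using that PiE_mem[of r "{..<2}" "\<lambda>_. {..<2}"] unfolding tuples_def by simp
  have tup_eq: "r = s" if "r \<in> tuples 2 2" "s \<in> tuples 2 2" "r 0 = s 0" "r 1 = s 1" for r s
    using that(1,2) unfolding tuples_def
  proof (rule PiE_ext)
    fix i :: nat assume "i \<in> {..<2}"
    then have "i = 0 \<or> i = 1" by auto
    then show "r i = s i" using that(3,4) by auto
  qed
  have sp: "span {\<one>} (map fst ps) = carrier G" "span {\<one>} (map snd ps) = carrier G"
    "span {\<one>} (map (\<lambda>(a, b). a \<otimes> b) ps) = carrier G"
    "span {\<one>} (map (\<lambda>(a, b). a \<otimes> inv b) ps) = carrier G"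
    using ps by (auto simp: pair_basis_def)
  \<comment> \<open>One of the two orders of each pair of distinct rows: exchanging the rows inverts the quotient.\<close>
  define S :: "(nat \<times> nat \<times> nat \<times> nat) set" where
    "S = {(1, 0, 0, 0), (0, 1, 0, 0), (1, 1, 0, 0), (1, 0, 0, 1), (1, 1, 1, 0), (1, 1, 0, 1)}"
  have forward: "bij_betw (?D r s) (tuples 2 l) (carrier G)"
    if "(r 0, r 1, s 0, s 1) \<in> S" for r s
    using that unfolding S_def
  proof (elim insertE emptyE)
    assume "(r 0, r 1, s 0, s 1) = (1, 0, 0, 0)"
    then show ?thesis by (intro bij[OF _ sp(1)]) auto
  next
    assume "(r 0, r 1, s 0, s 1) = (0, 1, 0, 0)"
    then show ?thesis by (intro bij[OF _ sp(2)]) auto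
  next
    assume "(r 0, r 1, s 0, s 1) = (1, 1, 0, 0)"
    then show ?thesis by (intro bij[OF _ sp(3)]) auto
  next
    assume "(r 0, r 1, s 0, s 1) = (1, 0, 0, 1)"
    then show ?thesis by (intro bij[OF _ sp(4)]) auto
  next
    assume "(r 0, r 1, s 0, s 1) = (1, 1, 1, 0)"
    moreover have "a \<otimes> b \<otimes> inv a = b" if "a \<in> carrier G" "b \<in> carrier G" for a b
      using that by (simp add: m_comm[of a b] m_assoc)
    ultimately show ?thesis by (intro bij[OF _ sp(2)]) auto
  next
    assume "(r 0, r 1, s 0, s 1) = (1, 1, 0, 1)"
    moreover have "a \<otimes> b \<otimes> inv b = a" if "a \<in> carrier G" "b \<in> carrier G" for a b
      using that by (simp add: m_assoc)
    ultimately show ?thesis by (intro bij[OF _ sp(1)]) auto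
  qed
  have fibre: "card {c \<in> tuples 2 l. ?D r s c = g} = 1"
    if r: "r \<in> tuples 2 2" "s \<in> tuples 2 2" "r \<noteq> s" and g: "g \<in> carrier G" for r s g
  proof -
    have "bij_betw (?D r s) (tuples 2 l) (carrier G) \<or> bij_betw (?D s r) (tuples 2 l) (carrier G)"
    proof -
      have "r 0 = 0 \<or> r 0 = 1" "r 1 = 0 \<or> r 1 = 1" "s 0 = 0 \<or> s 0 = 1" "s 1 = 0 \<or> s 1 = 1"
        using tup[OF r(1)] tup[OF r(2)] by auto
      moreover have "r 0 \<noteq> s 0 \<or> r 1 \<noteq> s 1" using tup_eq[OF r(1,2)] r(3) by blast
      ultimately have "(r 0, r 1, s 0, s 1) \<in> S \<or> (s 0, s 1, r 0, r 1) \<in> S"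
        unfolding S_def by (elim disjE) simp_all
      then show ?thesis by (elim disjE) (rule disjI1 disjI2, erule forward)+
    qed
    then show ?thesis
    proof
      assume "bij_betw (?D r s) (tuples 2 l) (carrier G)"
      then show ?thesis using g by (rule card_fibre_bij)
    next
      assume b: "bij_betw (?D s r) (tuples 2 l) (carrier G)"
      have "?D s r c = inv (?D r s c)" for c
        using ex_cl by (simp add: inv_mult m_comm)
      then have "{c \<in> tuples 2 l. ?D r s c = g} = {c \<in> tuples 2 l. ?D s r c = inv g}"
        using ex_cl g by (metis (no_types, lifting) inv_closed inv_inv m_closed)
      then show ?thesis using card_fibre_bij[OF b, of "inv g"] g by simp
    qed
  qed
  have "difference_matrix G (2 ^ 2) (2 ^ 0) (tuples 2 2) (tuples 2 (l + 0)) (expansion G 2 (l + 0) M)"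
    unfolding difference_matrix_def matrix_over_def
    using fibre ex_cl fin nt card finite_tuples card_tuples by (auto simp: order_def)
  moreover have "matrix_over G {..<2} {..<l + 0} M" using M by (auto simp: matrix_over_def)
  ultimately have "contracted_difference_matrix 2 G 2 0 M"
    unfolding contracted_difference_matrix_def using card comm_group_axioms
    by (auto simp: order_def intro!: exI[of _ l])
  then show ?thesis by (intro exI[of _ M])
qed

end

theorem corollary5p16:
  fixes G :: "('a, 'm) monoid_scheme" and n :: nat
  assumes "comm_group G"
    and "order G = 2 ^ n"
    and "\<not> cyclic_group G"
  shows "\<exists>M. contracted_difference_matrix 2 G 2 0 M"
proof -
  interpret comm_2_group G n
    by (rule comm_2_group.intro[OF assms(1) comm_2_group_axioms.intro[OF assms(2)]])
  obtain u v where "independent_involutions_mod {\<one>\<^bsub>G\<^esub>} u v" using ex_two_involutions assms by blast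
  then obtain ps where "pair_basis {\<one>\<^bsub>G\<^esub>} (carrier G) ps"
    using ex_pair_basis[OF triv_subgroup] by blast
  moreover have "carrier G \<noteq> {\<one>\<^bsub>G\<^esub>}"
    using assms trivial_imp_cyclic_group trivial_group by blast
  ultimately show ?thesis by (rule contracted_of_pair_basis)
qed

end
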